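(* Let $K$ be a field, let $G$ be a group with neutral element $\varepsilon$, let $A=\bigoplus_{g\in G}A_g$ be a finite-dimensional $G$-graded $K$-algebra with a homogeneous basis $(e_i)_{i\in J}$, where $J=\bigcup_{g\in G}J_g$ (disjoint union) and $(e_i)_{i\in J_g}$ is a basis of $A_g$ for each $g\in G$, and let $(c_{ij\ell})_{i,j,\ell\in J}$ be the associated structure constants, so that $e_ie_j=\sum_{\ell\in J}c_{ij\ell}e_\ell$ for all $i,j\in J$. Then $A$ is graded symmetric if and only if there exists a family of scalars $\alpha=(\alpha_\ell)_{\ell\in J_\varepsilon}$ in $K$ such that the $\varepsilon$-paratrophic matrix $P(\varepsilon,\alpha)$ is symmetric and invertible.
   Context: Algebras are associative and unital over the field $K$. A $G$-grading on $A$ is a decomposition $A=\bigoplus_{g\in G}A_g$ into subspaces with $A_gA_h\subseteq A_{gh}$ for all $g,h\in G$. If $A_g=0$, then $J_g=\emptyset$. The $\varepsilon$-paratrophic matrix $P(\varepsilon,\alpha)\in M_J(K)$ is the matrix with rows and columns indexed by $J$ whose $(i,j)$-entry is $\sum_{\ell\in J_\varepsilon}\alpha_\ell c_{ij\ell}$; a sum indexed by the empty set is $0$. The linear dual $A^*$ is an $A$-bimodule by $(r\rightharpoonup a^* )(a)=a^*(ar)$ and $(a^*\leftharpoonup r)(a)=a^*(ra)$ for $r,a\in A$, $a^*\in A^*$. It is graded with homogeneous component of degree $g\in G$ $$(A^* )_g=\{a^*\in A^*\mid a^*(A_h)=0\text{ for any }h\neq g^{-1}\}.$$ The algebra $A$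 is called graded symmetric if $A^*\simeq A$ as graded $A$-bimodules, i.e. there is an isomorphism of $A$-bimodules preserving degrees. *)

theory Defs
  imports Complex_Main "HOL-Algebra.Group" "HOL-Library.Disjoint_Sets"
begin

text \<open>The sort \<open>{ring, monoid_mult}\<close> describes associative unital rings in which
  \<open>0 = 1\<close> is permitted (unlike in \<open>ring_1\<close>), so the zero algebra is included.\<close>

locale unital_algebra = vector_space scale
  for scale :: "'k::field \<Rightarrow> 'a::{ring, monoid_mult} \<Rightarrow> 'a" +
  assumes scale_mult_left: "scale r x * y = scale r (x * y)"
    and scale_mult_right: "x * scale r y = scale r (x * y)"
begin

definition finite_dim :: bool where
  "finite_dim \<longleftrightarrow> (\<exists>B. finite B \<and> span B = UNIV)"

definition dual :: "('a \<Rightarrow> 'k) set" where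
  "dual = {f. Vector_Spaces.linear scale (*) f}"

end

definition dual_lact :: "'a \<Rightarrow> ('a \<Rightarrow> 'k) \<Rightarrow> 'a::times \<Rightarrow> 'k" where
  "dual_lact r f = (\<lambda>a. f (a * r))"

definition dual_ract :: "('a \<Rightarrow> 'k) \<Rightarrow> 'a \<Rightarrow> 'a::times \<Rightarrow> 'k" where
  "dual_ract f r = (\<lambda>a. f (r * a))"

locale graded_algebra = unital_algebra scale + group G
  for scale :: "'k::field \<Rightarrow> 'a::{ring, monoid_mult} \<Rightarrow> 'a"
    and G :: "('g, 'm) monoid_scheme" (structure) +
  fixes A :: "'g \<Rightarrow> 'a set"
  assumes subspace_component: "g \<in> carrier G \<Longrightarrow> subspace (A g)"
    and direct_sum:
      "\<exists>!f. (\<forall>g \<in> carrier G. f g \<in> A g) \<and> (\<forall>g. g \<notin> carrier G \<longrightarrow> f g = 0) \<and>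
            finite {g. f g \<noteq> 0} \<and> (\<Sum>g | f g \<noteq> 0. f g) = x"
    and component_mult:
      "\<lbrakk>g \<in> carrier G; h \<in> carrier G; x \<in> A g; y \<in> A h\<rbrakk> \<Longrightarrow> x * y \<in> A (g \<otimes> h)"
begin

definition dual_component :: "'g \<Rightarrow> ('a \<Rightarrow> 'k) set" where
  "dual_component g =
    {f \<in> dual. \<forall>h \<in> carrier G. h \<noteq> inv g \<longrightarrow> (\<forall>a \<in> A h. f a = 0)}"

definition graded_bimodule_iso :: "(('a \<Rightarrow> 'k) \<Rightarrow> 'a) \<Rightarrow> bool" where
  "graded_bimodule_iso \<phi> \<longleftrightarrow>
     bij_betw \<phi> dual UNIV \<and>
     (\<forall>f \<in> dual. \<forall>f' \<in> dual. \<phi> (\<lambda>a. f a + f' a) = \<phi> f + \<phi> f') \<and>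
     (\<forall>r. \<forall>f \<in> dual. \<phi> (\<lambda>a. r * f a) = scale r (\<phi> f)) \<and>
     (\<forall>r. \<forall>f \<in> dual. \<phi> (dual_lact r f) = r * \<phi> f) \<and>
     (\<forall>r. \<forall>f \<in> dual. \<phi> (dual_ract f r) = \<phi> f * r) \<and>
     (\<forall>g \<in> carrier G. \<phi> ` dual_component g \<subseteq> A g)"

definition graded_symmetric :: bool where
  "graded_symmetric \<longleftrightarrow> (\<exists>\<phi>. graded_bimodule_iso \<phi>)"

definition homogeneous_basis :: "('g \<Rightarrow> 'j set) \<Rightarrow> ('j \<Rightarrow> 'a) \<Rightarrow> bool" where
  "homogeneous_basis J e \<longleftrightarrow>
     disjoint_family_on J (carrier G) \<and>
     (\<forall>g \<in> carrier G. inj_on e (J g) \<and> independent (e ` J g) \<and> span (e ` J g) = A g)"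

end

text \<open>Matrices over a finite index set \<open>J\<close> are functions of two indices, of which only the
  values on \<open>J \<times> J\<close> matter. The family \<open>\<alpha>\<close> below is likewise only used on \<open>J g\<close>.\<close>

definition symmetric_on :: "'j set \<Rightarrow> ('j \<Rightarrow> 'j \<Rightarrow> 'k) \<Rightarrow> bool" where
  "symmetric_on J P \<longleftrightarrow> (\<forall>i \<in> J. \<forall>j \<in> J. P i j = P j i)"

definition invertible_on :: "'j set \<Rightarrow> ('j \<Rightarrow> 'j \<Rightarrow> 'k::field) \<Rightarrow> bool" where
  "invertible_on J P \<longleftrightarrow>
     (\<exists>Q. \<forall>i \<in> J. \<forall>j \<in> J.
        (\<Sum>k\<in>J. P i k * Q k j) = (if i = j then 1 else 0) \<and>
        (\<Sum>k\<in>J. Q i k * P k j) = (if i = j then 1 else 0))"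

definition paratrophic_matrix ::
    "('g \<Rightarrow> 'j set) \<Rightarrow> ('j \<Rightarrow> 'j \<Rightarrow> 'j \<Rightarrow> 'k::field) \<Rightarrow> 'g \<Rightarrow> ('j \<Rightarrow> 'k) \<Rightarrow> 'j \<Rightarrow> 'j \<Rightarrow> 'k" where
  "paratrophic_matrix J c g \<alpha> i j = (\<Sum>l\<in>J g. \<alpha> l * c i j l)"

end

theory Submission
  imports Defs
begin

text \<open>
  A graded bimodule isomorphism between \<open>A\<^sup>*\<close> and \<open>A\<close> is the same thing as a linear form
  \<open>\<lambda>\<close> of degree \<open>\<epsilon>\<close> with \<open>\<lambda>(xy) = \<lambda>(yx)\<close> for which \<open>r \<mapsto> (r \<rightharpoonup> \<lambda>)\<close>
  is a bijection \<open>A \<rightarrow> A\<^sup>*\<close> (lemma \<open>graded_symmetric_iff\<close>).  Given an isomorphism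
  \<open>\<phi>\<close>, the form is \<open>\<lambda> = \<phi>\<^sup>-\<^sup>1(1)\<close>: the two bimodule laws say that both
  \<open>r \<rightharpoonup> \<lambda>\<close> and \<open>\<lambda> \<leftharpoonup> r\<close> are \<open>\<phi>\<^sup>-\<^sup>1(r)\<close>, and \<open>\<lambda>\<close> has degree \<open>\<epsilon>\<close> because
  \<open>1 \<in> A\<^sub>\<epsilon>\<close>.  Conversely \<open>\<phi>\<close> is the inverse of \<open>r \<mapsto> (r \<rightharpoonup> \<lambda>)\<close>.

  A form of degree \<open>\<epsilon>\<close> is determined by its values \<open>\<alpha>\<^sub>l = \<lambda>(e\<^sub>l)\<close> for \<open>l \<in> J\<^sub>\<epsilon>\<close>, and
  these values are arbitrary.  Expanding \<open>e\<^sub>i e\<^sub>j\<close> in the basis shows that \<open>P(\<epsilon>, \<alpha>)\<close> is the Gram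
  matrix \<open>(\<lambda>(e\<^sub>i e\<^sub>j))\<close> (lemma \<open>paratrophic_matrix_eq\<close>).  It is symmetric precisely when
  \<open>\<lambda>\<close> is a trace form, and then invertible precisely when \<open>r \<mapsto> (r \<rightharpoonup> \<lambda>)\<close> is bijective
  (lemma \<open>invertible_gram_iff\<close>).
\<close>

section \<open>Linear forms\<close>

context unital_algebra
begin

lemma dual_iff:
  "f \<in> dual \<longleftrightarrow> (\<forall>x y. f (x + y) = f x + f y) \<and> (\<forall>r x. f (scale r x) = r * f x)"
proof -
  have "vector_space ((*) :: 'k \<Rightarrow> 'k \<Rightarrow> 'k)"
    by unfold_locales (simp_all add: algebra_simps)
  then show ?thesis
    using vector_space_axioms by (simp add: dual_def Vector_Spaces.linear_iff)
qed

lemma dual_add: "f \<in> dual \<Longrightarrow> f (x + y) = f x + f y"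
  and dual_scale: "f \<in> dual \<Longrightarrow> f (scale r x) = r * f x"
  by (simp_all add: dual_iff)

lemma dual_zero: "f \<in> dual \<Longrightarrow> f 0 = 0"
  using dual_scale[of f 0 0] by simp

lemma dual_sum: "f \<in> dual \<Longrightarrow> f (sum x I) = (\<Sum>i\<in>I. f (x i))"
  by (induction I rule: infinite_finite_induct) (simp_all add: dual_zero dual_add)

lemma dual_lact_dual: "f \<in> dual \<Longrightarrow> dual_lact r f \<in> dual"
  and dual_ract_dual: "f \<in> dual \<Longrightarrow> dual_ract f r \<in> dual"
  by (simp_all add: dual_iff dual_lact_def dual_ract_def distrib_left distrib_right
      scale_mult_left scale_mult_right)

lemma dual_add_dual: "f \<in> dual \<Longrightarrow> f' \<in> dual \<Longrightarrow> (\<lambda>a. f a + f' a) \<in> dual"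
  and dual_scale_dual: "f \<in> dual \<Longrightarrow> (\<lambda>a. r * f a) \<in> dual"
  and dual_zero_dual: "(\<lambda>a. 0) \<in> dual"
  by (simp_all add: dual_iff algebra_simps)

lemma dual_sum_dual:
  "(\<And>i. i \<in> I \<Longrightarrow> F i \<in> dual) \<Longrightarrow> (\<lambda>a. \<Sum>i\<in>I. F i a) \<in> dual"
  by (induction I rule: infinite_finite_induct) (simp_all add: dual_zero_dual dual_add_dual)

lemma dual_vanish_span:
  assumes "f \<in> dual" and "\<And>b. b \<in> B \<Longrightarrow> f b = 0" and "x \<in> span B"
  shows "f x = 0"
  using assms(3)
  by (induction rule: span_induct_alt) (simp_all add: assms(1,2) dual_zero dual_add dual_scale)

end

section \<open>Homogeneous components\<close>

context graded_algebra
begin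

lemma components_independent:
  assumes "finite S" and "S \<subseteq> carrier G" and "\<And>g. g \<in> S \<Longrightarrow> x g \<in> A g"
    and "(\<Sum>g\<in>S. x g) = 0" and "g \<in> S"
  shows "x g = 0"
proof -
  define decomp where "decomp = (\<lambda>f. (\<forall>h\<in>carrier G. f h \<in> A h) \<and>
      (\<forall>h. h \<notin> carrier G \<longrightarrow> f h = 0) \<and> finite {h. f h \<noteq> 0} \<and> (\<Sum>h | f h \<noteq> 0. f h) = 0)"
  define y where "y = (\<lambda>g. if g \<in> S then x g else 0)"
  have "(\<Sum>h | y h \<noteq> 0. y h) = (\<Sum>h\<in>S. x h)"
    using assms(1) by (intro sum.mono_neutral_cong_left) (auto simp: y_def split: if_splits)
  moreover have "finite {h. y h \<noteq> 0}"
    by (rule finite_subset[OF _ assms(1)]) (auto simp: y_def split: if_splits)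
  ultimately have y: "decomp y"
    using assms by (auto simp: decomp_def y_def intro: subspace_0 subspace_component)
  have zero: "decomp (\<lambda>_. 0)"
    by (auto simp: decomp_def intro: subspace_0 subspace_component)
  have "\<exists>!f. decomp f"
    unfolding decomp_def by (rule direct_sum)
  then have "y = (\<lambda>_. 0)"
    using y zero by (auto simp: Ex1_def)
  with assms(5) show ?thesis
    by (metis y_def)
qed

lemma components_disjoint:
  assumes "g \<in> carrier G" "h \<in> carrier G" "g \<noteq> h" "x \<in> A g" "x \<in> A h"
  shows "x = 0"
proof -
  have "- x \<in> A h"
    using assms by (intro subspace_neg subspace_component)
  then have "(if g = g then x else - x) = 0"
    using assms
    by (intro components_independent[of "{g, h}" "\<lambda>k. if k = g then x else - x" g]) auto
  then show ?thesis by simp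
qed

lemma span_components:
  assumes "\<And>g. g \<in> carrier G \<Longrightarrow> A g \<subseteq> span B"
  shows "span B = UNIV"
proof -
  have "x \<in> span B" for x
  proof -
    obtain f where "\<forall>g\<in>carrier G. f g \<in> A g" "\<forall>g. g \<notin> carrier G \<longrightarrow> f g = 0"
        and x: "(\<Sum>g | f g \<noteq> 0. f g) = x"
      using direct_sum[of x] by blast
    then have "f g \<in> span B" for g
      using assms by (cases "g \<in> carrier G") (auto simp: span_zero)
    then show ?thesis
      unfolding x[symmetric] by (intro span_sum)
  qed
  then show ?thesis by blast
qed

lemma independent_Union_components:
  assumes sub: "\<And>g. g \<in> carrier G \<Longrightarrow> B g \<subseteq> A g"
    and ind: "\<And>g. g \<in> carrier G \<Longrightarrow> independent (B g)"
  shows "independent (\<Union>g\<in>carrier G. B g)"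
  unfolding independent_explicit_finite_subsets
proof (intro allI impI ballI)
  fix S u v
  assume S: "S \<subseteq> (\<Union>g\<in>carrier G. B g)" "finite S"
    and zero: "(\<Sum>v\<in>S. scale (u v) v) = 0" and v: "v \<in> S"
  from S have "\<forall>w\<in>S. \<exists>g. g \<in> carrier G \<and> w \<in> B g" by blast
  then obtain deg where deg: "\<And>w. w \<in> S \<Longrightarrow> deg w \<in> carrier G \<and> w \<in> B (deg w)"
    by metis
  define s where "s = (\<lambda>g. \<Sum>w\<in>{w \<in> S. deg w = g}. scale (u w) w)"
  have "(\<Sum>g\<in>deg ` S. s g) = 0"
    unfolding s_def using S zero by (subst sum.group) auto
  moreover have "s g \<in> A g" if "g \<in> deg ` S" for g
  proof -
    have "subspace (A g)"
      using that deg by (auto intro: subspace_component)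
    then show ?thesis
      unfolding s_def using deg sub by (intro subspace_sum subspace_scale) auto
  qed
  ultimately have "s (deg v) = 0"
    using components_independent[of "deg ` S" s "deg v"] S v deg by auto
  then show "u v = 0"
    unfolding s_def using S v deg ind[of "deg v"]
    by (intro independentD[of "B (deg v)" "{w \<in> S. deg w = deg v}"]) (auto dest: deg)
qed

end

section \<open>Coordinates with respect to a homogeneous basis\<close>

text \<open>A finite-dimensional graded algebra with a homogeneous basis and its structure constants.\<close>

locale graded_algebra_with_basis = graded_algebra scale G A
  for scale :: "'k::field \<Rightarrow> 'a::{ring, monoid_mult} \<Rightarrow> 'a"
    and G :: "('g, 'm) monoid_scheme" (structure)
    and A :: "'g \<Rightarrow> 'a set" +
  fixes Jg :: "'g \<Rightarrow> 'j set"
    and J :: "'j set"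
    and e :: "'j \<Rightarrow> 'a"
    and c :: "'j \<Rightarrow> 'j \<Rightarrow> 'j \<Rightarrow> 'k"
  assumes finite_dim: "finite_dim"
    and homogeneous_basis: "homogeneous_basis Jg e"
    and J_eq: "J = (\<Union>g \<in> carrier G. Jg g)"
    and e_mult: "i \<in> J \<Longrightarrow> j \<in> J \<Longrightarrow> e i * e j = (\<Sum>l\<in>J. scale (c i j l) (e l))"
begin

lemma Jg_subset: "g \<in> carrier G \<Longrightarrow> Jg g \<subseteq> J"
  by (auto simp: J_eq)

lemma Jg_unique: "i \<in> Jg g \<Longrightarrow> i \<in> Jg h \<Longrightarrow> g \<in> carrier G \<Longrightarrow> h \<in> carrier G \<Longrightarrow> g = h"
  using homogeneous_basis unfolding homogeneous_basis_def disjoint_family_on_def by blast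

lemma component_eq_span: "g \<in> carrier G \<Longrightarrow> A g = span (e ` Jg g)"
  and independent_Jg: "g \<in> carrier G \<Longrightarrow> independent (e ` Jg g)"
  and inj_on_Jg: "g \<in> carrier G \<Longrightarrow> inj_on e (Jg g)"
  using homogeneous_basis unfolding homogeneous_basis_def by blast+

lemma e_component: "g \<in> carrier G \<Longrightarrow> i \<in> Jg g \<Longrightarrow> e i \<in> A g"
  by (auto simp: component_eq_span intro: span_base)

lemma independent_basis: "independent (e ` J)"
  unfolding J_eq image_UN
  by (intro independent_Union_components) (auto simp: e_component independent_Jg)

lemma span_basis: "span (e ` J) = UNIV"
  by (intro span_components) (simp add: component_eq_span J_eq span_mono image_mono UN_upper)

lemma inj_on_basis: "inj_on e J"
proof (rule inj_onI)
  fix i j assume ij: "i \<in> J" "j \<in> J" "e i = e j"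
  then obtain g h where gh: "g \<in> carrier G" "h \<in> carrier G" "i \<in> Jg g" "j \<in> Jg h"
    by (auto simp: J_eq)
  have "e i \<noteq> 0"
    using ij independent_basis dependent_zero by (metis imageI)
  then have "g = h"
    using gh ij components_disjoint[of g h "e i"] e_component by metis
  with gh ij show "i = j"
    using inj_on_Jg by (auto dest: inj_onD)
qed

lemma finite_J: "finite J"
proof -
  obtain B where "finite B" "span B = UNIV"
    using finite_dim by (auto simp: finite_dim_def)
  then have "finite (e ` J)"
    using independent_span_bound[OF _ independent_basis] by auto
  then show ?thesis
    using inj_on_basis by (rule finite_imageD)
qed

lemma finite_Jg: "g \<in> carrier G \<Longrightarrow> finite (Jg g)"
  using finite_J Jg_subset finite_subset by blast

text \<open>The coordinate forms; for \<open>i \<in> J\<close> they are the basis of the dual space dual to \<open>e\<close>.\<close>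

definition coord :: "'j \<Rightarrow> 'a \<Rightarrow> 'k" where
  "coord i x = representation (e ` J) x (e i)"

lemma coord_dual: "coord i \<in> dual"
  using linear_representation[OF independent_basis span_basis]
  by (simp add: dual_def coord_def[abs_def])

lemma coord_e: "i \<in> J \<Longrightarrow> j \<in> J \<Longrightarrow> coord i (e j) = (if i = j then 1 else 0)"
  using inj_on_basis by (auto simp: coord_def representation_basis independent_basis dest: inj_onD)

lemma coord_expand: "(\<Sum>i\<in>J. scale (coord i x) (e i)) = x"
proof -
  have "(\<Sum>b\<in>e ` J. scale (representation (e ` J) x b) b) = x"
    using span_basis finite_J
    by (intro sum_representation_eq independent_basis) auto
  then show ?thesis
    by (simp add: coord_def sum.reindex inj_on_basis)
qed

lemma coord_combination:
  "j \<in> J \<Longrightarrow> coord j (\<Sum>i\<in>J. scale (u i) (e i)) = u j"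
  using finite_J by (simp add: dual_sum dual_scale coord_dual coord_e if_distrib[of "(*) _"] cong: if_cong)

lemma dual_expand: "f \<in> dual \<Longrightarrow> f x = (\<Sum>i\<in>J. coord i x * f (e i))"
  using dual_sum[of f "\<lambda>i. scale (coord i x) (e i)" J] by (simp add: dual_scale coord_expand)

lemma dual_eqI:
  assumes "f \<in> dual" "f' \<in> dual" "\<And>i. i \<in> J \<Longrightarrow> f (e i) = f' (e i)"
  shows "f = f'"
proof
  show "f x = f' x" for x
    by (simp add: dual_expand[OF assms(1), of x] dual_expand[OF assms(2), of x] assms(3))
qed

lemma coord_eqI: "(\<And>i. i \<in> J \<Longrightarrow> coord i x = coord i y) \<Longrightarrow> x = y"
  by (subst (1 2) coord_expand[symmetric]) simp

lemma dual_vanish_component: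
  "\<lbrakk>f \<in> dual; g \<in> carrier G; \<And>i. i \<in> Jg g \<Longrightarrow> f (e i) = 0; x \<in> A g\<rbrakk> \<Longrightarrow> f x = 0"
  using dual_vanish_span[of f "e ` Jg g" x] by (auto simp: component_eq_span)

lemma coord_component:
  assumes "g \<in> carrier G" "x \<in> A g" "i \<in> J" "i \<notin> Jg g"
  shows "coord i x = 0"
proof (rule dual_vanish_component[OF coord_dual assms(1) _ assms(2)])
  fix k assume "k \<in> Jg g"
  then show "coord i (e k) = 0"
    using assms Jg_subset[of g] by (auto simp: coord_e)
qed

lemma componentI:
  assumes "g \<in> carrier G" "\<And>i. i \<in> J \<Longrightarrow> i \<notin> Jg g \<Longrightarrow> coord i x = 0"
  shows "x \<in> A g"
proof -
  have "(\<Sum>i\<in>J. scale (coord i x) (e i)) = (\<Sum>i\<in>Jg g. scale (coord i x) (e i))"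
    using assms Jg_subset finite_J by (intro sum.mono_neutral_right) auto
  also have "\<dots> \<in> A g"
    using assms by (intro subspace_sum subspace_scale subspace_component e_component)
  finally show ?thesis by (simp add: coord_expand)
qed

lemma dual_component_iff:
  assumes "g \<in> carrier G"
  shows "f \<in> dual_component g \<longleftrightarrow> f \<in> dual \<and> (\<forall>i\<in>J - Jg (inv g). f (e i) = 0)"
proof (intro iffI conjI)
  assume f: "f \<in> dual_component g"
  then show "f \<in> dual" by (simp add: dual_component_def)
  show "\<forall>i\<in>J - Jg (inv g). f (e i) = 0"
    using f e_component by (force simp: dual_component_def J_eq)
next
  assume f: "f \<in> dual \<and> (\<forall>i\<in>J - Jg (inv g). f (e i) = 0)"
  show "f \<in> dual_component g"
    unfolding dual_component_def
  proof (intro CollectI conjI ballI impI)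
    fix h a assume h: "h \<in> carrier G" "h \<noteq> inv g" "a \<in> A h"
    then have "Jg h \<subseteq> J - Jg (inv g)"
      using assms Jg_unique Jg_subset by blast
    with f have "f \<in> dual" "\<And>i. i \<in> Jg h \<Longrightarrow> f (e i) = 0"
      by blast+
    with h show "f a = 0"
      using dual_vanish_component by blast
  qed (use f in blast)
qed

lemma coord_dual_component:
  "g \<in> carrier G \<Longrightarrow> i \<in> Jg g \<Longrightarrow> coord i \<in> dual_component (inv g)"
  using Jg_subset by (auto simp: dual_component_iff coord_dual coord_e subset_iff)

lemma coord_sum_e:
  assumes "l \<in> J"
  shows "(\<Sum>i\<in>Jg \<one>. \<alpha> i * coord i (e l)) = (if l \<in> Jg \<one> then \<alpha> l else 0)"
proof -
  have "(\<Sum>i\<in>Jg \<one>. \<alpha> i * coord i (e l)) = (\<Sum>i\<in>Jg \<one>. if i = l then \<alpha> i else 0)"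
    using assms Jg_subset[of \<one>] by (intro sum.cong) (auto simp: coord_e)
  then show ?thesis
    using finite_Jg[of \<one>] by simp
qed

lemma coord_sum_dual_component: "(\<lambda>a. \<Sum>i\<in>Jg \<one>. \<alpha> i * coord i a) \<in> dual_component \<one>"
  by (simp add: dual_component_iff dual_sum_dual dual_scale_dual coord_dual coord_sum_e)

section \<open>The unit is homogeneous of degree one\<close>

text \<open>Comparing the components of degree \<open>h\<close> in \<open>e\<^sub>j = e\<^sub>j 1\<close>, where \<open>e\<^sub>j\<close> has degree \<open>h\<close>, shows
  that the component of degree \<open>\<epsilon>\<close> of the unit is already a right unit.\<close>

lemma one_component: "1 \<in> A \<one>"
proof -
  define u where "u = (\<Sum>i\<in>Jg \<one>. scale (coord i 1) (e i))"
  have u: "u \<in> A \<one>"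
    unfolding u_def by (intro subspace_sum subspace_scale subspace_component e_component) auto
  have e_u: "e j * u = e j" if j: "j \<in> J" for j
  proof (rule coord_eqI)
    fix k assume k: "k \<in> J"
    obtain h where h: "h \<in> carrier G" "j \<in> Jg h"
      using j by (auto simp: J_eq)
    show "coord k (e j * u) = coord k (e j)"
    proof (cases "k \<in> Jg h")
      case True
      have zero: "coord k (e j * e i) = 0" if i: "i \<in> J - Jg \<one>" for i
      proof -
        obtain g where g: "g \<in> carrier G" "i \<in> Jg g"
          using i by (auto simp: J_eq)
        then have "g \<noteq> \<one>" using i by auto
        then have "h \<otimes> g \<noteq> h" using g h by simp
        then have "k \<notin> Jg (h \<otimes> g)"
          using True Jg_unique[of k h "h \<otimes> g"] g h by auto
        moreover have "e j * e i \<in> A (h \<otimes> g)"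
          using g h by (intro component_mult e_component)
        ultimately show ?thesis
          using coord_component[of "h \<otimes> g" "e j * e i" k] g h k by simp
      qed
      have "e j = e j * (\<Sum>i\<in>J. scale (coord i 1) (e i))"
        by (simp add: coord_expand)
      then have "coord k (e j) = coord k (e j * (\<Sum>i\<in>J. scale (coord i 1) (e i)))"
        by simp
      also have "\<dots> = (\<Sum>i\<in>J. coord i 1 * coord k (e j * e i))"
        by (simp add: sum_distrib_left scale_mult_right dual_sum dual_scale coord_dual)
      also have "\<dots> = (\<Sum>i\<in>Jg \<one>. coord i 1 * coord k (e j * e i))"
        using zero finite_J Jg_subset[of \<one>] by (intro sum.mono_neutral_right) auto
      also have "\<dots> = coord k (e j * u)"
        by (simp add: u_def sum_distrib_left scale_mult_right dual_sum dual_scale coord_dual)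
      finally show ?thesis ..
    next
      case False
      have "e j * u \<in> A (h \<otimes> \<one>)"
        using h u by (intro component_mult e_component) auto
      with False h k show ?thesis
        using coord_component[of h] e_component by auto
    qed
  qed
  have "u = (\<Sum>i\<in>J. scale (coord i 1) (e i)) * u"
    by (simp add: coord_expand)
  also have "\<dots> = (\<Sum>i\<in>J. scale (coord i 1) (e i))"
    by (simp add: sum_distrib_right scale_mult_left e_u)
  also have "\<dots> = 1"
    by (rule coord_expand)
  finally have "u = 1" .
  with u show ?thesis by simp
qed

section \<open>Isomorphisms with the dual and trace forms\<close>

text \<open>A linear form is a symmetrizing form when it is symmetric on products and its left translates
  \<open>r \<rightharpoonup> f\<close> run through the dual space without repetition.\<close>

definition symmetrizing_form :: "('a \<Rightarrow> 'k) \<Rightarrow> bool" where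
  "symmetrizing_form f \<longleftrightarrow>
     f \<in> dual \<and> (\<forall>x y. f (x * y) = f (y * x)) \<and> bij_betw (\<lambda>r. dual_lact r f) UNIV dual"

lemma symmetrizing_form_of_iso:
  assumes "graded_bimodule_iso \<phi>"
  obtains f where "f \<in> dual_component \<one>" and "symmetrizing_form f"
proof -
  have bij: "bij_betw \<phi> dual UNIV"
    and add: "\<And>f f'. f \<in> dual \<Longrightarrow> f' \<in> dual \<Longrightarrow> \<phi> (\<lambda>a. f a + f' a) = \<phi> f + \<phi> f'"
    and scl: "\<And>r f. f \<in> dual \<Longrightarrow> \<phi> (\<lambda>a. r * f a) = scale r (\<phi> f)"
    and lact: "\<And>r f. f \<in> dual \<Longrightarrow> \<phi> (dual_lact r f) = r * \<phi> f"
    and ract: "\<And>r f. f \<in> dual \<Longrightarrow> \<phi> (dual_ract f r) = \<phi> f * r"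
    and grd: "\<And>g. g \<in> carrier G \<Longrightarrow> \<phi> ` dual_component g \<subseteq> A g"
    using assms by (simp_all add: graded_bimodule_iso_def)
  have inj: "f = f'" if "f \<in> dual" "f' \<in> dual" "\<phi> f = \<phi> f'" for f f'
    using bij that by (auto simp: bij_betw_def dest: inj_onD)
  obtain f where f: "f \<in> dual" "\<phi> f = 1"
    using bij unfolding bij_betw_def by (metis UNIV_I imageE)
  have sums: "\<phi> (\<lambda>a. \<Sum>i\<in>I. u i * coord i a) = (\<Sum>i\<in>I. scale (u i) (\<phi> (coord i)))"
    if "finite I" for I u
    using that
  proof induction
    case empty
    show ?case using scl[OF dual_zero_dual, of 0] by simp
  next
    case (insert i I)
    then show ?case
      by (simp add: add scl coord_dual dual_scale_dual dual_sum_dual)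
  qed
  \<comment> \<open>\<open>f'\<close> is the component of degree \<open>\<epsilon>\<close> of \<open>f\<close>. Its image is the component of degree \<open>\<epsilon>\<close>
    of \<open>1\<close>, which is \<open>1\<close> itself.\<close>
  define f' where "f' = (\<lambda>a. \<Sum>i\<in>Jg \<one>. f (e i) * coord i a)"
  have f'_deg: "f' \<in> dual_component \<one>"
    unfolding f'_def by (rule coord_sum_dual_component)
  then have f': "f' \<in> dual"
    by (simp add: dual_component_def)
  have "\<phi> f' = 1"
  proof (rule coord_eqI)
    fix k assume k: "k \<in> J"
    have img: "\<phi> (coord i) \<in> A (inv g)" if "i \<in> Jg g" "g \<in> carrier G" for i g
      using grd[of "inv g"] coord_dual_component[of g i] that by auto
    have zero1: "coord k (\<phi> (coord i)) = 0" if "k \<in> Jg \<one>" "i \<in> J - Jg \<one>" for i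
    proof -
      obtain g where g: "g \<in> carrier G" "i \<in> Jg g"
        using \<open>i \<in> J - Jg \<one>\<close> by (auto simp: J_eq)
      then have "inv g \<noteq> \<one>"
        using \<open>i \<in> J - Jg \<one>\<close> by (metis DiffD2 inv_inv inv_one)
      then have "k \<notin> Jg (inv g)"
        using Jg_unique[OF \<open>k \<in> Jg \<one>\<close>, of "inv g"] g(1) by (metis inv_closed one_closed)
      then show ?thesis
        using coord_component[of "inv g"] img g k by auto
    qed
    have f'_A: "\<phi> f' \<in> A \<one>"
      unfolding f'_def sums[OF finite_Jg[OF one_closed]]
      using img[of _ \<one>] by (intro subspace_sum subspace_scale subspace_component) auto
    have f_sum: "f = (\<lambda>a. \<Sum>i\<in>J. f (e i) * coord i a)"
      using f by (auto simp: dual_expand[of f] mult.commute)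
    show "coord k (\<phi> f') = coord k 1"
    proof (cases "k \<in> Jg \<one>")
      case True
      have "coord k 1 = coord k (\<phi> (\<lambda>a. \<Sum>i\<in>J. f (e i) * coord i a))"
        using f f_sum by simp
      also have "\<dots> = (\<Sum>i\<in>J. f (e i) * coord k (\<phi> (coord i)))"
        by (simp add: sums finite_J dual_sum dual_scale coord_dual)
      also have "\<dots> = (\<Sum>i\<in>Jg \<one>. f (e i) * coord k (\<phi> (coord i)))"
        using zero1 True finite_J Jg_subset[of \<one>] by (intro sum.mono_neutral_right) auto
      also have "\<dots> = coord k (\<phi> f')"
        by (simp add: f'_def sums finite_Jg dual_sum dual_scale coord_dual)
      finally show ?thesis ..
    next
      case False
      then show ?thesis
        using coord_component[of \<one>] f'_A one_component k by auto
    qed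
  qed
  then have "f' = f"
    using inj f f' by simp
  with f'_deg have "f \<in> dual_component \<one>"
    by simp
  moreover have "dual_lact r f = dual_ract f r" for r
    using f by (intro inj dual_lact_dual dual_ract_dual) (simp_all add: lact ract)
  then have "f (x * y) = f (y * x)" for x y
    by (metis dual_lact_def dual_ract_def)
  moreover have "bij_betw (\<lambda>r. dual_lact r f) UNIV dual"
    by (rule bij_betw_byWitness[where f' = \<phi>])
      (use f in \<open>auto simp: lact dual_lact_dual intro!: inj\<close>)
  ultimately show ?thesis
    using that f by (simp add: symmetrizing_form_def)
qed

lemma iso_of_symmetrizing_form:
  assumes deg: "f \<in> dual_component \<one>" and form: "symmetrizing_form f"
  shows "graded_bimodule_iso (inv_into UNIV (\<lambda>r. dual_lact r f))"
proof -
  define \<psi> where "\<psi> = (\<lambda>r. dual_lact r f)"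
  define \<phi> where "\<phi> = inv_into UNIV \<psi>"
  have f: "f \<in> dual" and sym: "\<And>x y. f (x * y) = f (y * x)" and bij: "bij_betw \<psi> UNIV dual"
    using form by (auto simp: symmetrizing_form_def \<psi>_def)
  have \<psi>_\<phi>: "\<psi> (\<phi> h) = h" if "h \<in> dual" for h
    using bij that by (simp add: \<phi>_def bij_betw_inv_into_right)
  have \<phi>_eq: "\<phi> h = r" if "\<psi> r = h" for h r
    using bij that by (auto simp: \<phi>_def bij_betw_inv_into_left)
  have app: "f (a * \<phi> h) = h a" if "h \<in> dual" for h a
    using \<psi>_\<phi>[OF that] by (auto simp: \<psi>_def dual_lact_def fun_eq_iff)
  have "graded_bimodule_iso \<phi>"
    unfolding graded_bimodule_iso_def
  proof (intro conjI ballI allI)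
    show "bij_betw \<phi> dual UNIV"
      unfolding \<phi>_def by (rule bij_betw_inv_into[OF bij])
    show "\<phi> (\<lambda>a. h a + h' a) = \<phi> h + \<phi> h'" if "h \<in> dual" "h' \<in> dual" for h h'
      by (rule \<phi>_eq) (use that f in \<open>simp add: \<psi>_def dual_lact_def distrib_left dual_add app\<close>)
    show "\<phi> (\<lambda>a. r * h a) = scale r (\<phi> h)" if "h \<in> dual" for r h
      by (rule \<phi>_eq) (use that f in \<open>simp add: \<psi>_def dual_lact_def scale_mult_right dual_scale app\<close>)
    show "\<phi> (dual_lact r h) = r * \<phi> h" if "h \<in> dual" for r h
      by (rule \<phi>_eq) (use that in \<open>simp add: \<psi>_def dual_lact_def mult.assoc[symmetric] app\<close>)
    show "\<phi> (dual_ract h r) = \<phi> h * r" if "h \<in> dual" for r h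
    proof (rule \<phi>_eq)
      have "f (a * (\<phi> h * r)) = h (r * a)" for a
      proof -
        have "f (a * (\<phi> h * r)) = f (r * (a * \<phi> h))"
          using sym[of "a * \<phi> h" r] by (simp add: mult.assoc)
        then show ?thesis
          using that by (simp add: mult.assoc[symmetric] app)
      qed
      then show "\<psi> (\<phi> h * r) = dual_ract h r"
        by (simp add: \<psi>_def dual_lact_def dual_ract_def)
    qed
    show "\<phi> ` dual_component g \<subseteq> A g" if g: "g \<in> carrier G" for g
    proof (intro image_subsetI)
      fix h assume h: "h \<in> dual_component g"
      then have hd: "h \<in> dual" by (simp add: dual_component_def)
      \<comment> \<open>The component \<open>x\<close> of degree \<open>g\<close> of \<open>\<phi> h\<close> already satisfies \<open>(x \<rightharpoonup> f) = h\<close>.\<close>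
      define x where "x = (\<Sum>i\<in>Jg g. scale (coord i (\<phi> h)) (e i))"
      have x: "x \<in> A g"
        unfolding x_def using g by (intro subspace_sum subspace_scale subspace_component e_component)
      have f_zero: "f y = 0" if "y \<in> A k" "k \<in> carrier G" "k \<noteq> \<one>" for k y
        using deg that by (simp add: dual_component_def)
      have "\<psi> x = h"
      proof (rule dual_eqI)
        show "\<psi> x \<in> dual" using f by (simp add: \<psi>_def dual_lact_dual)
        fix j assume "j \<in> J"
        then obtain k where k: "k \<in> carrier G" "j \<in> Jg k" by (auto simp: J_eq)
        show "\<psi> x (e j) = h (e j)"
        proof (cases "k = inv g")
          case False
          then have "k \<otimes> g \<noteq> \<one>"
            using k g inv_equality by metis
          moreover have "e j * x \<in> A (k \<otimes> g)"
            using k g x by (intro component_mult e_component)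
          ultimately have "f (e j * x) = 0"
            using f_zero k g by blast
          moreover have "h (e j) = 0"
            using h False k e_component by (auto simp: dual_component_def)
          ultimately show ?thesis by (simp add: \<psi>_def dual_lact_def)
        next
          case True
          have zero: "f (e j * e i) = 0" if i: "i \<in> J - Jg g" for i
          proof -
            obtain l where l: "l \<in> carrier G" "i \<in> Jg l"
              using i by (auto simp: J_eq)
            then have "l \<noteq> g" using i by auto
            then have "k \<otimes> l \<noteq> \<one>"
              using True g l by (metis inv_closed inv_equality inv_inv)
            moreover have "e j * e i \<in> A (k \<otimes> l)"
              using k l by (intro component_mult e_component)
            ultimately show ?thesis
              using f_zero k l by blast
          qed
          have "h (e j) = f (e j * (\<Sum>i\<in>J. scale (coord i (\<phi> h)) (e i)))"
            by (simp add: coord_expand app hd)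
          also have "\<dots> = (\<Sum>i\<in>J. coord i (\<phi> h) * f (e j * e i))"
            using f by (simp add: sum_distrib_left scale_mult_right dual_sum dual_scale)
          also have "\<dots> = (\<Sum>i\<in>Jg g. coord i (\<phi> h) * f (e j * e i))"
            using zero finite_J Jg_subset[OF g] by (intro sum.mono_neutral_right) auto
          also have "\<dots> = f (e j * x)"
            using f by (simp add: x_def sum_distrib_left scale_mult_right dual_sum dual_scale)
          finally show ?thesis by (simp add: \<psi>_def dual_lact_def)
        qed
      qed (rule hd)
      then have "\<phi> h = x" by (rule \<phi>_eq)
      with x show "\<phi> h \<in> A g" by simp
    qed
  qed
  then show ?thesis by (simp add: \<phi>_def \<psi>_def)
qed

lemma graded_symmetric_iff:
  "graded_symmetric \<longleftrightarrow> (\<exists>f \<in> dual_component \<one>. symmetrizing_form f)"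
  unfolding graded_symmetric_def
  using symmetrizing_form_of_iso iso_of_symmetrizing_form by blast

section \<open>Gram matrices\<close>

lemma symmetric_gram_iff:
  assumes f: "f \<in> dual"
  shows "symmetric_on J (\<lambda>i j. f (e i * e j)) \<longleftrightarrow> (\<forall>x y. f (x * y) = f (y * x))"
proof
  assume sym: "symmetric_on J (\<lambda>i j. f (e i * e j))"
  have "dual_lact (e j) f = dual_ract f (e j)" if "j \<in> J" for j
    using dual_lact_dual[OF f] dual_ract_dual[OF f]
    by (rule dual_eqI) (use sym that in \<open>simp add: dual_lact_def dual_ract_def symmetric_on_def\<close>)
  then have *: "f (x * e j) = f (e j * x)" if "j \<in> J" for j x
    using that by (metis dual_lact_def dual_ract_def)
  have "dual_lact y f = dual_ract f y" for y
    using dual_lact_dual[OF f] dual_ract_dual[OF f]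
    by (rule dual_eqI) (simp add: dual_lact_def dual_ract_def *)
  then show "\<forall>x y. f (x * y) = f (y * x)"
    by (metis dual_lact_def dual_ract_def)
qed (simp add: symmetric_on_def)

lemma invertible_gram_iff:
  assumes f: "f \<in> dual" and sym: "\<And>x y. f (x * y) = f (y * x)"
  shows "invertible_on J (\<lambda>i j. f (e i * e j)) \<longleftrightarrow> bij_betw (\<lambda>r. dual_lact r f) UNIV dual"
proof
  have expand: "f (e i * x) = (\<Sum>k\<in>J. f (e i * e k) * coord k x)" for i x
  proof -
    have "f (e i * x) = f (e i * (\<Sum>k\<in>J. scale (coord k x) (e k)))"
      by (simp add: coord_expand)
    also have "\<dots> = (\<Sum>k\<in>J. f (e i * e k) * coord k x)"
      using f by (simp add: sum_distrib_left scale_mult_right dual_sum dual_scale mult.commute)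
    finally show ?thesis .
  qed
  {
    assume "invertible_on J (\<lambda>i j. f (e i * e j))"
    then obtain Q where Q: "\<forall>i\<in>J. \<forall>j\<in>J.
        (\<Sum>k\<in>J. f (e i * e k) * Q k j) = (if i = j then 1 else 0) \<and>
        (\<Sum>k\<in>J. Q i k * f (e k * e j)) = (if i = j then 1 else 0)"
      unfolding invertible_on_def by blast
    then have PQ: "(\<Sum>k\<in>J. f (e i * e k) * Q k j) = (if i = j then 1 else 0)"
      and QP: "(\<Sum>k\<in>J. Q i k * f (e k * e j)) = (if i = j then 1 else 0)"
      if "i \<in> J" "j \<in> J" for i j
      using that by blast+
    define w where "w = (\<lambda>h :: 'a \<Rightarrow> 'k. \<Sum>k\<in>J. scale (\<Sum>j\<in>J. Q k j * h (e j)) (e k))"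
    have right: "w (dual_lact r f) = r" for r
    proof (rule coord_eqI)
      fix k assume k: "k \<in> J"
      have "coord k (w (dual_lact r f)) = (\<Sum>j\<in>J. Q k j * f (e j * r))"
        using k by (simp add: w_def coord_combination dual_lact_def)
      also have "\<dots> = (\<Sum>j\<in>J. \<Sum>i\<in>J. Q k j * f (e j * e i) * coord i r)"
        by (simp add: expand[of _ r] sum_distrib_left mult.assoc)
      also have "\<dots> = (\<Sum>i\<in>J. (\<Sum>j\<in>J. Q k j * f (e j * e i)) * coord i r)"
        by (subst sum.swap) (simp add: sum_distrib_right)
      also have "\<dots> = (\<Sum>i\<in>J. if k = i then coord i r else 0)"
        using k by (intro sum.cong) (simp_all add: QP)
      also have "\<dots> = coord k r"
        using k finite_J by simp
      finally show "coord k (w (dual_lact r f)) = coord k r" .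
    qed
    have left: "dual_lact (w h) f = h" if h: "h \<in> dual" for h
    proof (rule dual_eqI)
      fix i assume i: "i \<in> J"
      have "dual_lact (w h) f (e i) = (\<Sum>k\<in>J. f (e i * e k) * (\<Sum>j\<in>J. Q k j * h (e j)))"
        by (simp add: dual_lact_def expand[of _ "w h"]) (simp add: w_def coord_combination)
      also have "\<dots> = (\<Sum>j\<in>J. (\<Sum>k\<in>J. f (e i * e k) * Q k j) * h (e j))"
        by (simp add: sum_distrib_left sum_distrib_right mult.assoc) (rule sum.swap)
      also have "\<dots> = (\<Sum>j\<in>J. if i = j then h (e j) else 0)"
        using i by (intro sum.cong) (simp_all add: PQ)
      also have "\<dots> = h (e i)"
        using i finite_J by simp
      finally show "dual_lact (w h) f (e i) = h (e i)" .
    qed (use f h in \<open>auto simp: dual_lact_dual\<close>)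
    show "bij_betw (\<lambda>r. dual_lact r f) UNIV dual"
      by (rule bij_betw_byWitness[where f' = w])
        (use f in \<open>auto simp: left right dual_lact_dual\<close>)
  }
  {
    assume bij: "bij_betw (\<lambda>r. dual_lact r f) UNIV dual"
    \<comment> \<open>The elements \<open>r j\<close> form the dual basis: \<open>f (e i * r j)\<close> is the Kronecker symbol.\<close>
    have "\<exists>r. dual_lact r f = coord j" for j
      using bij coord_dual[of j] unfolding bij_betw_def by (metis imageE)
    then obtain r where "\<And>j. dual_lact (r j) f = coord j" by metis
    then have r: "f (x * r j) = coord j x" for j x
      by (metis dual_lact_def)
    define Q where "Q = (\<lambda>k j. coord k (r j))"
    \<comment> \<open>Symmetry of \<open>Q\<close> and of the Gram matrix turns a right inverse into a two-sided one.\<close>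
    have Q_sym: "Q i j = Q j i" for i j
      using sym[of "r i" "r j"] by (simp add: Q_def r)
    have PQ: "(\<Sum>k\<in>J. f (e i * e k) * Q k j) = (if i = j then 1 else 0)"
      if "i \<in> J" "j \<in> J" for i j
    proof -
      have "(\<Sum>k\<in>J. f (e i * e k) * Q k j) = f (e i * r j)"
        by (simp add: expand[of i "r j"] Q_def)
      then show ?thesis
        using that by (simp add: r coord_e eq_commute)
    qed
    have QP: "(\<Sum>k\<in>J. Q i k * f (e k * e j)) = (if i = j then 1 else 0)"
      if "i \<in> J" "j \<in> J" for i j
      using PQ[OF that(2,1)] by (simp add: Q_sym[of i] sym[of _ "e j"] mult.commute eq_commute)
    show "invertible_on J (\<lambda>i j. f (e i * e j))"
      unfolding invertible_on_def using PQ QP by blast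
  }
qed

lemma paratrophic_matrix_eq:
  assumes f: "f \<in> dual_component \<one>" and \<alpha>: "\<And>l. l \<in> Jg \<one> \<Longrightarrow> f (e l) = \<alpha> l"
    and "i \<in> J" "j \<in> J"
  shows "paratrophic_matrix Jg c \<one> \<alpha> i j = f (e i * e j)"
proof -
  have fd: "f \<in> dual" and zero: "\<forall>l\<in>J - Jg \<one>. f (e l) = 0"
    using f by (simp_all add: dual_component_iff)
  have "f (e i * e j) = (\<Sum>l\<in>J. c i j l * f (e l))"
    using assms fd by (simp add: e_mult dual_sum dual_scale)
  also have "\<dots> = (\<Sum>l\<in>Jg \<one>. c i j l * f (e l))"
    using zero finite_J Jg_subset[of \<one>] by (intro sum.mono_neutral_right) auto
  also have "\<dots> = paratrophic_matrix Jg c \<one> \<alpha> i j"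
    by (simp add: paratrophic_matrix_def \<alpha> mult.commute)
  finally show ?thesis ..
qed

lemma paratrophic_matrix_symmetrizing_iff:
  assumes f: "f \<in> dual_component \<one>" and \<alpha>: "\<And>l. l \<in> Jg \<one> \<Longrightarrow> f (e l) = \<alpha> l"
  shows "symmetric_on J (paratrophic_matrix Jg c \<one> \<alpha>) \<and>
      invertible_on J (paratrophic_matrix Jg c \<one> \<alpha>) \<longleftrightarrow> symmetrizing_form f"
proof -
  have fd: "f \<in> dual" using f by (simp add: dual_component_def)
  have "symmetric_on J (paratrophic_matrix Jg c \<one> \<alpha>) \<longleftrightarrow>
      symmetric_on J (\<lambda>i j. f (e i * e j))"
    and "invertible_on J (paratrophic_matrix Jg c \<one> \<alpha>) \<longleftrightarrow>
      invertible_on J (\<lambda>i j. f (e i * e j))"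
    using paratrophic_matrix_eq[OF f \<alpha>] by (simp_all add: symmetric_on_def invertible_on_def)
  then show ?thesis
    using fd symmetric_gram_iff[OF fd] invertible_gram_iff[OF fd]
    unfolding symmetrizing_form_def by blast
qed

lemma graded_symmetric_iff_paratrophic:
  "graded_symmetric \<longleftrightarrow>
    (\<exists>\<alpha>. symmetric_on J (paratrophic_matrix Jg c \<one> \<alpha>) \<and>
         invertible_on J (paratrophic_matrix Jg c \<one> \<alpha>))"
proof
  assume "graded_symmetric"
  then obtain f where "f \<in> dual_component \<one>" "symmetrizing_form f"
    by (auto simp: graded_symmetric_iff)
  then show "\<exists>\<alpha>. symmetric_on J (paratrophic_matrix Jg c \<one> \<alpha>) \<and>
      invertible_on J (paratrophic_matrix Jg c \<one> \<alpha>)"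
    using paratrophic_matrix_symmetrizing_iff[of f "\<lambda>l. f (e l)"] by blast
next
  assume "\<exists>\<alpha>. symmetric_on J (paratrophic_matrix Jg c \<one> \<alpha>) \<and>
      invertible_on J (paratrophic_matrix Jg c \<one> \<alpha>)"
  then obtain \<alpha> where \<alpha>: "symmetric_on J (paratrophic_matrix Jg c \<one> \<alpha>) \<and>
      invertible_on J (paratrophic_matrix Jg c \<one> \<alpha>)" ..
  define f where "f = (\<lambda>a. \<Sum>i\<in>Jg \<one>. \<alpha> i * coord i a)"
  have "f \<in> dual_component \<one>"
    unfolding f_def by (rule coord_sum_dual_component)
  moreover have "f (e l) = \<alpha> l" if "l \<in> Jg \<one>" for l
    using that Jg_subset[of \<one>] by (auto simp: f_def coord_sum_e)
  ultimately show "graded_symmetric"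
    using \<alpha> paratrophic_matrix_symmetrizing_iff[of f \<alpha>] by (auto simp: graded_symmetric_iff)
qed

end

section \<open>The criterion\<close>

theorem propositionB:
  fixes scale :: "'k::field \<Rightarrow> 'a::{ring, monoid_mult} \<Rightarrow> 'a"
    and G :: "('g, 'm) monoid_scheme"
    and A :: "'g \<Rightarrow> 'a set"
    and Jg :: "'g \<Rightarrow> 'j set"
    and J :: "'j set"
    and e :: "'j \<Rightarrow> 'a"
    and c :: "'j \<Rightarrow> 'j \<Rightarrow> 'j \<Rightarrow> 'k"
  assumes "graded_algebra scale G A"
    and "unital_algebra.finite_dim scale"
    and "graded_algebra.homogeneous_basis scale G A Jg e"
    and "J = (\<Union>g \<in> carrier G. Jg g)"
    and "\<And>i j. i \<in> J \<Longrightarrow> j \<in> J \<Longrightarrow> e i * e j = (\<Sum>l\<in>J. scale (c i j l) (e l))"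
  shows "graded_algebra.graded_symmetric scale G A \<longleftrightarrow>
    (\<exists>\<alpha> :: 'j \<Rightarrow> 'k.
       symmetric_on J (paratrophic_matrix Jg c \<one>\<^bsub>G\<^esub> \<alpha>) \<and>
       invertible_on J (paratrophic_matrix Jg c \<one>\<^bsub>G\<^esub> \<alpha>))"
proof -
  interpret graded_algebra_with_basis scale G A Jg J e c
    using assms by (intro graded_algebra_with_basis.intro graded_algebra_with_basis_axioms.intro)
  show ?thesis by (rule graded_symmetric_iff_paratrophic)
qed

end
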